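(* Let $n$ be a positive integer and let $T: M_n\to M_n$ be a linear surjective map. Then the following are equivalent: (1) $T$ is a Schur multiplicative contraction; (2) there are permutation unitaries $u,v$ in $M_n$ such that either $T(a)=uav$ for all $a\in M_n$, or $T(a)=ua^tv$ for all $a\in M_n$.
   Context: $M_n$ is the space of $n\times n$ complex matrices, equipped with the operator norm (as operators on the Hilbert space $\mathbb{C}^n$). For $a=[a_{ij}]$, $b=[b_{ij}]$ in $M_n$, the Schur product is the entrywise product $a\ast b=[a_{ij}b_{ij}]$. A linear map $T$ on $M_n$ is Schur multiplicative if $T(a)\ast T(b)=T(a\ast b)$ for all $a,b\in M_n$. $T$ is contractive (a contraction) if its operator norm as a linear map on the normed space $M_n$ satisfies $\|T\|_{\mathrm{op}}\le 1$. $a^t$ denotes the transpose of $a$. A permutation unitary in $M_n$ is a permutation matrix (a matrix that permutes the canonical basis vectors of $\mathbb{C}^n$). Products such as $uav$ are ordinary matrix products. *)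

theory Defs
  imports "HOL-Analysis.Analysis"
begin

text \<open>\<open>M\<^sub>n\<close> is the type \<open>complex^'n^'n\<close> with \<open>n = CARD('n)\<close>.\<close>

definition matrix_scale :: "complex \<Rightarrow> complex^'n^'n \<Rightarrow> complex^'n^'n" where
  "matrix_scale c a = (\<chi> i j. c * a $ i $ j)"

lemma vector_space_matrix_scale: "vector_space matrix_scale"
  by unfold_locales (simp_all add: matrix_scale_def vec_eq_iff algebra_simps)

definition schur_product :: "complex^'n^'n \<Rightarrow> complex^'n^'n \<Rightarrow> complex^'n^'n" where
  "schur_product a b = (\<chi> i j. a $ i $ j * b $ i $ j)"

definition schur_multiplicative :: "(complex^'n^'n \<Rightarrow> complex^'n^'n) \<Rightarrow> bool" where
  "schur_multiplicative T \<longleftrightarrow>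
     (\<forall>a b. schur_product (T a) (T b) = T (schur_product a b))"

text \<open>The \<open>norm\<close> that the library puts on \<open>complex^'n^'n\<close> is the Frobenius norm. The norm
  meant here is the operator norm of a matrix acting on the Hilbert space \<open>complex^'n\<close>.\<close>

definition matrix_norm :: "complex^'n^'n \<Rightarrow> real" where
  "matrix_norm a = onorm (\<lambda>x. a *v x)"

text \<open>This repeats the formula of \<^const>\<open>onorm\<close>, with \<^const>\<open>matrix_norm\<close> as the norm on both sides.
  The quotient is \<open>0\<close> at \<open>a = 0\<close>. For linear \<open>T\<close> the quotients are bounded, since the space is
  finite-dimensional, so the real-valued supremum is the true one.\<close>

definition map_norm :: "(complex^'n^'n \<Rightarrow> complex^'n^'n) \<Rightarrow> real" where
  "map_norm T = (SUP a. matrix_norm (T a) / matrix_norm a)"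

definition contractive :: "(complex^'n^'n \<Rightarrow> complex^'n^'n) \<Rightarrow> bool" where
  "contractive T \<longleftrightarrow> map_norm T \<le> 1"

definition permutation_unitary :: "complex^'n^'n \<Rightarrow> bool" where
  "permutation_unitary u \<longleftrightarrow>
     (\<exists>p. p permutes (UNIV :: 'n set) \<and> (\<forall>j. u *v axis j 1 = axis (p j) 1))"

end

theory Submission
  imports Defs
begin

text \<open>
  Under the Schur product, the matrices form the algebra of all complex functions on the grid of
  index pairs, and every nonzero multiplicative linear functional on such an algebra is evaluation
  at a point. Each entry of \<open>T a\<close> is such a functional of \<open>a\<close>, so a Schur multiplicative linear
  surjection only moves entries around: the entry of \<open>T a\<close> at \<open>p\<close> is the entry of \<open>a\<close> at \<open>\<sigma> p\<close>, for
  some injection \<open>\<sigma>\<close> of the grid (\<open>schur_multiplicative_surj_rearranges\<close>).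

  The operator norm detects rows and columns. The sum of two distinct matrix units has norm \<open>1\<close> if
  they share neither a row nor a column, and norm \<open>sqrt 2\<close> otherwise. If \<open>T\<close> is a contraction, then
  \<open>\<sigma>\<close> cannot separate two positions on a common line, since \<open>T\<close> would take a matrix of norm \<open>1\<close>
  to one of norm \<open>sqrt 2\<close> (\<open>contractive_rearrangement_preserves_lines\<close>). The only injections
  that preserve lines are the products of a permutation of the rows and one of the columns, possibly
  preceded by the reflection in the diagonal (\<open>line_preserving_injection\<close>). These are the maps
  that multiplication by permutation unitaries and transposition induce on positions.

  For the converse, rearrangements of entries are Schur multiplicative, and permuting rows, permuting
  columns and transposing do not increase the operator norm.
\<close>

section \<open>Entries of a matrix and its operator norm\<close>

definition matrix_unit :: "'n::finite \<times> 'n \<Rightarrow> complex^'n^'n" where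
  "matrix_unit q = (\<chi> i j. if (i, j) = q then 1 else 0)"

lemma matrix_unit_nth [simp]: "matrix_unit q $ i $ j = (if (i, j) = q then 1 else 0)"
  by (simp add: matrix_unit_def)

lemma matrix_scale_nth [simp]: "matrix_scale c a $ i $ j = c * a $ i $ j"
  by (simp add: matrix_scale_def)

lemma schur_product_nth [simp]: "schur_product a b $ i $ j = a $ i $ j * b $ i $ j"
  by (simp add: schur_product_def)

lemma matrix_eq_sum_matrix_unit:
  "a = (\<Sum>q\<in>UNIV. matrix_scale (a $ fst q $ snd q) (matrix_unit q))"
proof -
  have "(\<Sum>q\<in>UNIV. a $ fst q $ snd q * (if (i, j) = q then 1 else 0)) = a $ i $ j" for i j
    by (subst sum.remove[of _ "(i, j)"]) auto
  then show ?thesis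
    by (simp add: vec_eq_iff)
qed

lemma norm_matrix_vector_mult_le: "norm (a *v x) \<le> matrix_norm a * norm x"
  unfolding matrix_norm_def by (rule onorm[OF matrix_vector_mul_bounded_linear])

lemma matrix_norm_leI: "(\<And>x. norm (a *v x) \<le> C * norm x) \<Longrightarrow> matrix_norm a \<le> C"
  unfolding matrix_norm_def by (rule onorm_le)

lemma matrix_norm_nonneg: "0 \<le> matrix_norm a"
  unfolding matrix_norm_def by (rule onorm_pos_le[OF matrix_vector_mul_bounded_linear])

lemma norm_axis_complex [simp]: "norm (axis i (1::complex) :: complex^'n) = 1"
  by (simp add: norm_vec_def L2_set_def axis_def if_distrib[of norm] if_distrib[of "\<lambda>x. x\<^sup>2"] cong: if_cong)

lemma norm_entry_le_matrix_norm: "norm (a $ i $ j) \<le> matrix_norm a"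
proof -
  have "(a *v axis j 1) $ i = a $ i $ j"
    by (simp add: matrix_vector_mult_def axis_def if_distrib[of "\<lambda>x. _ * x"] cong: if_cong)
  then have "norm (a $ i $ j) \<le> norm (a *v axis j 1)"
    by (metis Finite_Cartesian_Product.norm_nth_le)
  also have "\<dots> \<le> matrix_norm a * norm (axis j (1::complex))"
    by (rule norm_matrix_vector_mult_le)
  finally show ?thesis
    by simp
qed

lemma norm_vec_le_sum: "norm (x :: 'a::real_normed_vector^'n) \<le> (\<Sum>i\<in>UNIV. norm (x $ i))"
  unfolding norm_vec_def by (rule L2_set_le_sum) simp

text \<open>Together with \<open>matrix_norm_le_norm\<close> below, this makes the operator norm equivalent to the
  Frobenius norm. Equivalence is all that is wanted, so the constants are crude.\<close>

lemma norm_le_matrix_norm: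
  fixes a :: "complex^'n^'n"
  shows "norm a \<le> real (CARD('n) * CARD('n)) * matrix_norm a"
proof -
  have "norm a \<le> (\<Sum>i\<in>UNIV. \<Sum>j\<in>UNIV. norm (a $ i $ j))"
    by (rule order_trans[OF norm_vec_le_sum]) (intro sum_mono norm_vec_le_sum)
  also have "\<dots> \<le> (\<Sum>i\<in>(UNIV::'n set). \<Sum>j\<in>(UNIV::'n set). matrix_norm a)"
    by (intro sum_mono norm_entry_le_matrix_norm)
  finally show ?thesis
    by (simp add: mult.assoc)
qed

lemma matrix_norm_le_norm:
  fixes a :: "complex^'n^'n"
  shows "matrix_norm a \<le> real (CARD('n) * CARD('n)) * norm a"
proof (rule matrix_norm_leI)
  fix x :: "complex^'n"
  have "norm (a $ i $ j) \<le> norm a" for i j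
    by (metis Finite_Cartesian_Product.norm_nth_le order_trans)
  then have "norm (a $ i $ j * x $ j) \<le> norm a * norm x" for i j
    by (simp add: norm_mult mult_mono Finite_Cartesian_Product.norm_nth_le)
  then have "(\<Sum>i\<in>UNIV. \<Sum>j\<in>UNIV. norm (a $ i $ j * x $ j))
      \<le> (\<Sum>i\<in>(UNIV::'n set). \<Sum>j\<in>(UNIV::'n set). norm a * norm x)"
    by (intro sum_mono)
  moreover have "norm (a *v x) \<le> (\<Sum>i\<in>UNIV. \<Sum>j\<in>UNIV. norm (a $ i $ j * x $ j))"
    by (rule order_trans[OF norm_vec_le_sum])
      (auto simp: matrix_vector_mult_def intro!: sum_mono norm_sum)
  ultimately show "norm (a *v x) \<le> real (CARD('n) * CARD('n)) * norm a * norm x"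
    by (simp add: mult.assoc)
qed

text \<open>A supremum of an unbounded set of reals has no meaning, so the substance of the direction from
  left to right is that the quotients are bounded. They are because \<open>T\<close> is bounded for the Frobenius
  norm, as is every linear map on a finite-dimensional space.\<close>

lemma contractive_iff_matrix_norm_le:
  fixes T :: "complex^'n^'n \<Rightarrow> complex^'n^'n"
  assumes "Vector_Spaces.linear matrix_scale matrix_scale T"
  shows "contractive T \<longleftrightarrow> (\<forall>a. matrix_norm (T a) \<le> matrix_norm a)"
proof
  interpret T: Vector_Spaces.linear matrix_scale matrix_scale T by fact
  have scaleR: "matrix_scale (complex_of_real r) a = r *\<^sub>R a" for r and a :: "complex^'n^'n"
    by (simp add: vec_eq_iff) (simp add: scaleR_conv_of_real)
  have "linear T"
    by (rule linearI) (simp_all add: T.add flip: scaleR add: T.scale)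
  then have "bounded_linear T"
    by (simp add: linear_conv_bounded_linear)
  then obtain K where K: "K \<ge> 0" "\<And>a. norm (T a) \<le> norm a * K"
    using bounded_linear.nonneg_bounded by blast
  define N where "N = real (CARD('n) * CARD('n))"
  have N: "N \<ge> 0"
    by (simp add: N_def)
  have bound: "matrix_norm (T a) \<le> N * N * K * matrix_norm a" for a
  proof -
    have "matrix_norm (T a) \<le> N * norm (T a)"
      unfolding N_def by (rule matrix_norm_le_norm)
    also have "\<dots> \<le> N * (norm a * K)"
      by (intro mult_left_mono K N)
    also have "\<dots> \<le> N * (N * matrix_norm a * K)"
      using norm_le_matrix_norm[of a] K N by (intro mult_left_mono mult_right_mono) (simp_all add: N_def)
    finally show ?thesis
      by (simp add: mult_ac)
  qed
  have bdd: "bdd_above (range (\<lambda>a. matrix_norm (T a) / matrix_norm a))"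
  proof (rule bdd_aboveI2)
    fix a
    show "matrix_norm (T a) / matrix_norm a \<le> N * N * K"
      using bound[of a] matrix_norm_nonneg[of a] N K
      by (cases "matrix_norm a = 0") (simp_all add: divide_le_eq)
  qed
  assume contr: "contractive T"
  show "\<forall>a. matrix_norm (T a) \<le> matrix_norm a"
  proof
    fix a
    have "matrix_norm (T a) / matrix_norm a \<le> 1"
      using cSUP_upper[OF UNIV_I bdd, of a] contr by (simp add: contractive_def map_norm_def)
    moreover have "matrix_norm (T a) \<le> 0" if "matrix_norm a = 0"
      using bound[of a] that by simp
    ultimately show "matrix_norm (T a) \<le> matrix_norm a"
      using matrix_norm_nonneg[of a] by (cases "matrix_norm a = 0") (simp_all add: divide_le_eq)
  qed
next
  assume "\<forall>a. matrix_norm (T a) \<le> matrix_norm a"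
  then have "matrix_norm (T a) / matrix_norm a \<le> 1" for a
    using matrix_norm_nonneg[of a] by (cases "matrix_norm a = 0") (simp_all add: divide_le_eq)
  then show "contractive T"
    unfolding contractive_def map_norm_def by (intro cSUP_least) auto
qed

section \<open>Schur multiplicative surjections rearrange entries\<close>

text \<open>The functional \<open>\<phi> a = T a $ i $ j\<close> is nonzero because \<open>T\<close> is surjective, so it does not vanish
  on some matrix unit \<open>e\<close>. The Schur product of \<open>a\<close> and \<open>e\<close> is \<open>e\<close> scaled by the entry of \<open>a\<close> at its
  position; applying \<open>\<phi>\<close> and cancelling \<open>\<phi> e\<close> shows that \<open>\<phi> a\<close> is that entry. Two positions with the
  same source would always carry equal entries in the range of \<open>T\<close>, so surjectivity also makes
  \<open>\<sigma>\<close> injective.\<close>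

lemma schur_multiplicative_surj_rearranges:
  fixes T :: "complex^'n^'n \<Rightarrow> complex^'n^'n"
  assumes "Vector_Spaces.linear matrix_scale matrix_scale T"
    and "surj T" and mult: "schur_multiplicative T"
  obtains \<sigma> where "inj \<sigma>" "\<And>a i j. T a $ i $ j = a $ fst (\<sigma> (i, j)) $ snd (\<sigma> (i, j))"
proof -
  interpret T: Vector_Spaces.linear matrix_scale matrix_scale T by fact
  have "\<exists>q. \<forall>a. T a $ i $ j = a $ fst q $ snd q" for i j
  proof -
    have "\<exists>q. T (matrix_unit q) $ i $ j \<noteq> 0"
    proof (rule ccontr)
      assume "\<nexists>q. T (matrix_unit q) $ i $ j \<noteq> 0"
      then have zero: "T (matrix_unit q) $ i $ j = 0" for q
        by blast
      have "T a $ i $ j = 0" for a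
        by (subst matrix_eq_sum_matrix_unit[of a])
          (simp add: T.sum T.scale zero)
      moreover obtain b where "T b = matrix_unit (i, j)"
        using \<open>surj T\<close> by (metis surjD)
      ultimately show False
        by (metis matrix_unit_nth zero_neq_one)
    qed
    then obtain q where q: "T (matrix_unit q) $ i $ j \<noteq> 0"
      by blast
    have "T a $ i $ j = a $ fst q $ snd q" for a
    proof -
      have "schur_product a (matrix_unit q) = matrix_scale (a $ fst q $ snd q) (matrix_unit q)"
        by (auto simp: vec_eq_iff)
      then have "schur_product (T a) (T (matrix_unit q)) =
          matrix_scale (a $ fst q $ snd q) (T (matrix_unit q))"
        using mult by (simp add: schur_multiplicative_def T.scale)
      then have "T a $ i $ j * T (matrix_unit q) $ i $ j = a $ fst q $ snd q * T (matrix_unit q) $ i $ j"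
        by (metis matrix_scale_nth schur_product_nth)
      with q show ?thesis
        by simp
    qed
    then show ?thesis
      by blast
  qed
  then have "\<forall>p. \<exists>q. \<forall>a. T a $ fst p $ snd p = a $ fst q $ snd q"
    by simp
  then obtain \<sigma> where \<sigma>: "\<And>p a. T a $ fst p $ snd p = a $ fst (\<sigma> p) $ snd (\<sigma> p)"
    by metis
  have "inj \<sigma>"
  proof (rule injI, rule ccontr)
    fix p p' assume eq: "\<sigma> p = \<sigma> p'" and "p \<noteq> p'"
    obtain b where "T b = matrix_unit p"
      using \<open>surj T\<close> by (metis surjD)
    then show False
      using \<sigma>[of b p] \<sigma>[of b p'] eq \<open>p \<noteq> p'\<close> by simp
  qed
  with \<sigma> show ?thesis
    using that by (metis fst_conv snd_conv)
qed

section \<open>Injections of the grid that preserve lines\<close>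

definition same_line :: "'n \<times> 'n \<Rightarrow> 'n \<times> 'n \<Rightarrow> bool" where
  "same_line p q \<longleftrightarrow> fst p = fst q \<or> snd p = snd q"

text \<open>By a count, each row fills the row that it is sent to, so distinct rows go to distinct rows. Two
  positions in one column then have images in different rows, and as these images share a line, they
  share a column.\<close>

lemma rows_to_rows_split:
  fixes \<sigma> :: "'n::finite \<times> 'n \<Rightarrow> 'n \<times> 'n"
  assumes inj: "inj \<sigma>"
    and lines: "\<And>p q. same_line p q \<Longrightarrow> same_line (\<sigma> p) (\<sigma> q)"
    and rows: "\<And>i j j'. fst (\<sigma> (i, j)) = fst (\<sigma> (i, j'))"
  obtains f g where "inj f" "inj g" "\<And>i j. \<sigma> (i, j) = (f i, g j)"
proof -
  (* An arbitrary index, used only to name the common value along a row or column. *)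
  fix i\<^sub>0 :: 'n
  define f where "f i = fst (\<sigma> (i, i\<^sub>0))" for i
  define g where "g j = snd (\<sigma> (i\<^sub>0, j))" for j
  have f: "fst (\<sigma> (i, j)) = f i" for i j
    unfolding f_def by (rule rows)
  have inj_snd: "inj (\<lambda>j. snd (\<sigma> (i, j)))" for i
  proof (rule injI)
    fix j j' assume "snd (\<sigma> (i, j)) = snd (\<sigma> (i, j'))"
    then have "\<sigma> (i, j) = \<sigma> (i, j')"
      using f by (simp add: prod_eq_iff)
    then show "j = j'"
      using inj by (auto dest: injD)
  qed
  have "inj f"
  proof (rule injI)
    fix i i' assume "f i = f i'"
    obtain j where "snd (\<sigma> (i', i\<^sub>0)) = snd (\<sigma> (i, j))"
      using surjD[OF finite_UNIV_inj_surj[OF finite inj_snd[of i]]] by blast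
    then have "\<sigma> (i, j) = \<sigma> (i', i\<^sub>0)"
      using f \<open>f i = f i'\<close> by (simp add: prod_eq_iff)
    then show "i = i'"
      using inj by (auto dest: injD)
  qed
  have g: "snd (\<sigma> (i, j)) = g j" for i j
  proof (cases "i = i\<^sub>0")
    case False
    then have "fst (\<sigma> (i, j)) \<noteq> fst (\<sigma> (i\<^sub>0, j))"
      using f \<open>inj f\<close> by (simp add: inj_eq)
    then show ?thesis
      using lines[of "(i, j)" "(i\<^sub>0, j)"] by (simp add: same_line_def g_def)
  qed (simp add: g_def)
  have "inj g"
    using inj_snd[of i\<^sub>0] unfolding g_def .
  then show ?thesis
    using that \<open>inj f\<close> f g by (metis prod.collapse)
qed

text \<open>Pairwise collinear positions all lie on a single line, so every row is sent into a row or into a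
  column. A row sent into a row and a row sent into a column would fill two crossing lines, and
  injectivity fails at the crossing. Hence all rows behave alike, and a swap of coordinates reduces
  the second case to the first.\<close>

lemma line_preserving_injection:
  fixes \<sigma> :: "'n::finite \<times> 'n \<Rightarrow> 'n \<times> 'n"
  assumes inj: "inj \<sigma>"
    and lines: "\<And>p q. same_line p q \<Longrightarrow> same_line (\<sigma> p) (\<sigma> q)"
  obtains f g where "inj f" "inj g"
    "(\<forall>i j. \<sigma> (i, j) = (f i, g j)) \<or> (\<forall>i j. \<sigma> (i, j) = (g j, f i))"
proof -
  have row: "(\<forall>j j'. fst (\<sigma> (i, j)) = fst (\<sigma> (i, j'))) \<or> (\<forall>j j'. snd (\<sigma> (i, j)) = snd (\<sigma> (i, j')))" for i
    using lines[of "(i, _)" "(i, _)"] unfolding same_line_def fst_conv by metis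
  have "(\<forall>i j j'. fst (\<sigma> (i, j)) = fst (\<sigma> (i, j'))) \<or> (\<forall>i j j'. snd (\<sigma> (i, j)) = snd (\<sigma> (i, j')))"
  proof (rule ccontr)
    assume "\<not> ?thesis"
    then obtain i i' where "i \<noteq> i'"
      and i: "\<And>j j'. snd (\<sigma> (i, j)) = snd (\<sigma> (i, j'))"
      and i': "\<And>j j'. fst (\<sigma> (i', j)) = fst (\<sigma> (i', j'))"
      using row by metis
    have "inj (\<lambda>j. fst (\<sigma> (i, j)))"
      using inj_eq[OF inj] i by (metis (lifting) injI prod_eqI prod.inject)
    moreover have "inj (\<lambda>j. snd (\<sigma> (i', j)))"
      using inj_eq[OF inj] i' by (metis (lifting) injI prod_eqI prod.inject)
    ultimately have surj: "surj (\<lambda>j. fst (\<sigma> (i, j)))" "surj (\<lambda>j. snd (\<sigma> (i', j)))"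
      by (simp_all add: finite_UNIV_inj_surj)
    obtain j where "fst (\<sigma> (i', i')) = fst (\<sigma> (i, j))"
      using surjD[OF surj(1)] by blast
    moreover obtain j' where "snd (\<sigma> (i, i)) = snd (\<sigma> (i', j'))"
      using surjD[OF surj(2)] by blast
    ultimately have "\<sigma> (i, j) = \<sigma> (i', j')"
      using i[of j i] i'[of j' i'] by (simp add: prod_eq_iff)
    then show False
      using inj \<open>i \<noteq> i'\<close> by (auto dest: injD)
  qed
  then show ?thesis
  proof
    assume "\<forall>i j j'. fst (\<sigma> (i, j)) = fst (\<sigma> (i, j'))"
    then show ?thesis
      using rows_to_rows_split[OF inj lines] that by metis
  next
    assume cols: "\<forall>i j j'. snd (\<sigma> (i, j)) = snd (\<sigma> (i, j'))"
    have "inj (prod.swap \<circ> \<sigma>)"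
      using inj by (simp add: inj_compose)
    moreover have "same_line ((prod.swap \<circ> \<sigma>) p) ((prod.swap \<circ> \<sigma>) q)" if "same_line p q" for p q
      using lines[OF that] by (auto simp: same_line_def)
    moreover have "fst ((prod.swap \<circ> \<sigma>) (i, j)) = fst ((prod.swap \<circ> \<sigma>) (i, j'))" for i j j'
      using cols by simp
    ultimately obtain f g where fg: "inj f" "inj g" "\<And>i j. (prod.swap \<circ> \<sigma>) (i, j) = (f i, g j)"
      by (rule rows_to_rows_split) (assumption | rule that)+
    have "\<sigma> (i, j) = (g j, f i)" for i j
      using fg(3)[of i j] by (simp add: prod_eq_iff)
    with fg that show ?thesis
      by blast
  qed
qed

section \<open>The norm sees whether two unit entries share a line\<close>

text \<open>Such a matrix copies two distinct coordinates of the vector to two distinct places and drops the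
  others.\<close>

lemma matrix_norm_two_units_le:
  fixes p q :: "'n::finite \<times> 'n"
  assumes "\<not> same_line p q"
  shows "matrix_norm (matrix_unit p + matrix_unit q) \<le> 1"
proof (rule matrix_norm_leI)
  fix x :: "complex^'n"
  obtain r c r' c' where pq: "p = (r, c)" "q = (r', c')"
    by (metis prod.collapse)
  with assms have ne: "r \<noteq> r'" "c \<noteq> c'"
    by (auto simp: same_line_def)
  let ?y = "(matrix_unit p + matrix_unit q) *v x"
  have y: "?y $ i = (if i = r then x $ c else if i = r' then x $ c' else 0)" for i
  proof -
    have "?y $ i = (\<Sum>j\<in>UNIV. (if j = c then if i = r then x $ j else 0 else 0)
        + (if j = c' then if i = r' then x $ j else 0 else 0))"
      by (auto simp: matrix_vector_mult_def pq distrib_right intro!: sum.cong)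
    then show ?thesis
      using ne by (simp add: sum.distrib)
  qed
  have "(\<Sum>i\<in>UNIV. (norm (?y $ i))\<^sup>2) = (\<Sum>i\<in>{r, r'}. (norm (?y $ i))\<^sup>2)"
    by (rule sum.mono_neutral_right) (auto simp: y)
  also have "\<dots> = (\<Sum>j\<in>{c, c'}. (norm (x $ j))\<^sup>2)"
    using ne by (simp add: y)
  also have "\<dots> \<le> (\<Sum>j\<in>UNIV. (norm (x $ j))\<^sup>2)"
    by (rule sum_mono2) auto
  finally show "norm ?y \<le> 1 * norm x"
    by (simp add: norm_vec_def L2_set_def)
qed

text \<open>Two ones in a row take the sum of two basis vectors, of norm \<open>sqrt 2\<close>, to twice a basis vector.
  Two ones in a column take a basis vector to a sum of two.\<close>

lemma matrix_norm_two_units_gt: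
  fixes p q :: "'n::finite \<times> 'n"
  assumes "same_line p q" "p \<noteq> q"
  shows "matrix_norm (matrix_unit p + matrix_unit q) > 1"
proof -
  let ?a = "matrix_unit p + matrix_unit q"
  obtain r c r' c' where pq: "p = (r, c)" "q = (r', c')"
    by (metis prod.collapse)
  have norm_two: "norm (axis i 1 + axis j (1::complex) :: complex^'n) = sqrt 2" if "i \<noteq> j" for i j
  proof -
    have "(\<Sum>k\<in>UNIV. (norm ((axis i 1 + axis j (1::complex)) $ k))\<^sup>2)
        = (\<Sum>k\<in>{i, j}. (norm ((axis i 1 + axis j (1::complex)) $ k))\<^sup>2)"
      by (rule sum.mono_neutral_right) (auto simp: axis_def)
    also have "\<dots> = 2"
      using that by (simp add: axis_def)
    finally show ?thesis
      by (simp add: norm_vec_def L2_set_def)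
  qed
  show ?thesis
  proof (cases "r = r'")
    case True
    with assms pq have ne: "c \<noteq> c'"
      by auto
    have "(?a *v (axis c 1 + axis c' 1)) $ r = (\<Sum>j\<in>UNIV. (if j = c then 1 else 0) + (if j = c' then 1 else 0))"
      using ne by (auto simp: matrix_vector_mult_def pq True axis_def intro!: sum.cong)
    then have "(?a *v (axis c 1 + axis c' 1)) $ r = 2"
      by (simp add: sum.distrib)
    then have "2 \<le> norm (?a *v (axis c 1 + axis c' 1))"
      by (metis Finite_Cartesian_Product.norm_nth_le norm_numeral)
    also have "\<dots> \<le> matrix_norm ?a * sqrt 2"
      using norm_matrix_vector_mult_le[of ?a "axis c 1 + axis c' 1"] norm_two[OF ne] by simp
    finally have "sqrt 2 * sqrt 2 \<le> matrix_norm ?a * sqrt 2"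
      by simp
    then have "sqrt 2 \<le> matrix_norm ?a"
      by (rule mult_right_le_imp_le) simp
    then show ?thesis
      by (rule less_le_trans[rotated]) simp
  next
    case False
    with assms pq have c: "c' = c"
      by (auto simp: same_line_def)
    have "?a *v axis c 1 = axis r 1 + axis r' 1"
    proof -
      have "(?a *v axis c 1) $ i = (\<Sum>j\<in>UNIV. if j = c then (axis r 1 + axis r' 1) $ i else 0)" for i
        unfolding matrix_vector_mult_def vec_lambda_beta
        by (rule sum.cong) (auto simp: pq c axis_def)
      then show ?thesis
        by (simp add: vec_eq_iff)
    qed
    then have "sqrt 2 \<le> matrix_norm ?a"
      using norm_matrix_vector_mult_le[of ?a "axis c 1"] norm_two[OF False] by simp
    then show ?thesis
      by (rule less_le_trans[rotated]) simp
  qed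
qed

text \<open>The test matrix has its ones at \<open>\<sigma> p\<close> and \<open>\<sigma> q\<close>; \<open>T\<close> moves them back to \<open>p\<close> and \<open>q\<close>.\<close>

lemma contractive_rearrangement_preserves_lines:
  fixes T :: "complex^'n^'n \<Rightarrow> complex^'n^'n"
  assumes contr: "\<And>a. matrix_norm (T a) \<le> matrix_norm a"
    and "inj \<sigma>"
    and T: "\<And>a i j. T a $ i $ j = a $ fst (\<sigma> (i, j)) $ snd (\<sigma> (i, j))"
    and "same_line p q"
  shows "same_line (\<sigma> p) (\<sigma> q)"
proof (cases "p = q")
  case False
  show ?thesis
  proof (rule ccontr)
    assume "\<not> same_line (\<sigma> p) (\<sigma> q)"
    then have "matrix_norm (T (matrix_unit (\<sigma> p) + matrix_unit (\<sigma> q))) \<le> 1"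
      using contr matrix_norm_two_units_le order_trans by blast
    moreover have "T (matrix_unit (\<sigma> p) + matrix_unit (\<sigma> q)) = matrix_unit p + matrix_unit q"
      using \<open>inj \<sigma>\<close> by (simp add: vec_eq_iff T inj_eq)
    ultimately show False
      using matrix_norm_two_units_gt[OF \<open>same_line p q\<close> False] by simp
  qed
qed (simp add: same_line_def)

section \<open>Permutation unitaries and norm invariance\<close>

definition perm_matrix :: "('n::finite \<Rightarrow> 'n) \<Rightarrow> complex^'n^'n" where
  "perm_matrix p = (\<chi> i j. if i = p j then 1 else 0)"

lemma permutation_unitary_iff:
  fixes u :: "complex^'n^'n"
  shows "permutation_unitary u \<longleftrightarrow> (\<exists>p. bij p \<and> u = perm_matrix p)"
proof -
  have "(u *v axis j 1) $ i = u $ i $ j" for i j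
    by (simp add: matrix_vector_mult_def axis_def if_distrib[of "\<lambda>x. _ * x"] cong: if_cong)
  then have "(\<forall>j. u *v axis j 1 = axis (p j) 1) \<longleftrightarrow> u = perm_matrix p" for p
    by (auto simp: vec_eq_iff perm_matrix_def axis_def)
  moreover have "p permutes (UNIV :: 'n set) \<longleftrightarrow> bij p" for p
    by (auto intro: permutes_bij bij_imp_permutes)
  ultimately show ?thesis
    by (simp add: permutation_unitary_def)
qed

text \<open>The inverse appears on the left because \<open>perm_matrix p\<close> sends the basis vector at \<open>j\<close> to the one at
  \<open>p j\<close>: left multiplication by it puts row \<open>j\<close> in place \<open>p j\<close>, while right multiplication reads
  column \<open>p j\<close> into place \<open>j\<close>.\<close>

lemma perm_matrix_mult_mult:
  fixes a :: "complex^'n^'n"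
  assumes "bij f"
  shows "perm_matrix (inv f) ** a ** perm_matrix g = (\<chi> i j. a $ f i $ g j)"
proof -
  have "i = inv f k \<longleftrightarrow> k = f i" for i k
    using assms by (metis bij_inv_eq_iff)
  then show ?thesis
    by (simp add: vec_eq_iff perm_matrix_def matrix_matrix_mult_def
        if_distrib[of "\<lambda>x. _ * x"] if_distrib[of "\<lambda>x. x * _"] cong: if_cong)
qed

lemma ex_permutation_unitary_iff:
  fixes T S :: "complex^'n^'n \<Rightarrow> complex^'n^'n"
  shows "(\<exists>u v. permutation_unitary u \<and> permutation_unitary v \<and> (\<forall>a. T a = u ** S a ** v)) \<longleftrightarrow>
    (\<exists>f g. bij f \<and> bij g \<and> (\<forall>a i j. T a $ i $ j = S a $ f i $ g j))"
    (is "?L \<longleftrightarrow> ?R")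
proof
  assume ?L
  then obtain p g where "bij p" "bij g" "\<forall>a. T a = perm_matrix p ** S a ** perm_matrix g"
    by (auto simp: permutation_unitary_iff)
  moreover from \<open>bij p\<close> have "bij (inv p)" "inv (inv p) = p"
    by (simp_all add: bij_imp_bij_inv inv_inv_eq)
  ultimately have "T a $ i $ j = S a $ inv p i $ g j" for a i j
    using perm_matrix_mult_mult[of "inv p"] by simp
  with \<open>bij (inv p)\<close> \<open>bij g\<close> show ?R
    by blast
next
  assume ?R
  then obtain f g where fg: "bij f" "bij g" "\<forall>a. T a = (\<chi> i j. S a $ f i $ g j)"
    by (auto simp: vec_eq_iff)
  then have "T a = perm_matrix (inv f) ** S a ** perm_matrix g" for a
    by (simp add: perm_matrix_mult_mult)
  moreover have "permutation_unitary (perm_matrix (inv f))" "permutation_unitary (perm_matrix g)"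
    using fg by (auto simp: permutation_unitary_iff intro: bij_imp_bij_inv)
  ultimately show ?L
    by blast
qed

lemma norm_vec_reindex:
  fixes x :: "'a::real_normed_vector^'n"
  assumes "bij f"
  shows "norm (\<chi> i. x $ f i) = norm x"
  unfolding norm_vec_def L2_set_def
  using sum.reindex_bij_betw[OF assms, of "\<lambda>i. (norm (x $ i))\<^sup>2"] by simp

lemma matrix_norm_reindex_le:
  fixes a :: "complex^'n^'n" and f g :: "'n \<Rightarrow> 'n"
  assumes "bij f" "bij g"
  shows "matrix_norm (\<chi> i j. a $ f i $ g j) \<le> matrix_norm a"
proof (rule matrix_norm_leI)
  fix x :: "complex^'n"
  let ?x = "\<chi> j. x $ inv g j"
  have "bij (inv g)"
    using assms by (simp add: bij_imp_bij_inv)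
  have "(\<Sum>j\<in>UNIV. a $ i $ g j * x $ j) = (\<Sum>j\<in>UNIV. a $ i $ j * x $ inv g j)" for i
    using sum.reindex_bij_betw[OF \<open>bij g\<close>, of "\<lambda>j. a $ i $ j * x $ inv g j"] \<open>bij g\<close>
    by (simp add: bij_is_inj)
  then have "(\<chi> i j. a $ f i $ g j) *v x = (\<chi> i. (a *v ?x) $ f i)"
    by (simp add: vec_eq_iff matrix_vector_mult_def)
  then have "norm ((\<chi> i j. a $ f i $ g j) *v x) = norm (a *v ?x)"
    using norm_vec_reindex[OF \<open>bij f\<close>] by simp
  also have "\<dots> \<le> matrix_norm a * norm ?x"
    by (rule norm_matrix_vector_mult_le)
  also have "norm ?x = norm x"
    using norm_vec_reindex[OF \<open>bij (inv g)\<close>] .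
  finally show "norm ((\<chi> i j. a $ f i $ g j) *v x) \<le> matrix_norm a * norm x" .
qed

text \<open>For \<open>y = transpose a *v x\<close>, the square of the norm of \<open>y\<close> is the bilinear pairing of \<open>y\<close> with its
  conjugate \<open>z\<close>. Moving \<open>a\<close> to the other side turns it into the pairing of \<open>x\<close> with \<open>a *v z\<close>, to which
  Cauchy-Schwarz applies. The conjugation is needed because the pairing is bilinear, and it does not
  change the norm.\<close>

lemma matrix_norm_transpose_le:
  fixes a :: "complex^'n^'n"
  shows "matrix_norm (transpose a) \<le> matrix_norm a"
proof (rule matrix_norm_leI)
  fix x :: "complex^'n"
  define y where "y = transpose a *v x"
  define z where "z = (\<chi> i. cnj (y $ i))"
  have norm_z: "norm z = norm y"
    by (simp add: z_def norm_vec_def)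
  have "complex_of_real ((norm y)\<^sup>2) = (\<Sum>i\<in>UNIV. complex_of_real ((norm (y $ i))\<^sup>2))"
    by (simp add: norm_vec_def L2_set_def sum_nonneg)
  also have "\<dots> = (\<Sum>i\<in>UNIV. y $ i * z $ i)"
    by (simp add: z_def complex_norm_square del: of_real_power)
  also have "\<dots> = (\<Sum>i\<in>UNIV. \<Sum>j\<in>UNIV. a $ j $ i * x $ j * z $ i)"
    by (simp add: y_def matrix_vector_mult_def transpose_def sum_distrib_right)
  also have "\<dots> = (\<Sum>j\<in>UNIV. x $ j * (a *v z) $ j)"
    by (subst sum.swap) (simp add: matrix_vector_mult_def sum_distrib_left mult_ac)
  finally have "(norm y)\<^sup>2 = norm (\<Sum>j\<in>UNIV. x $ j * (a *v z) $ j)"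
    by (metis norm_of_real abs_power2 abs_norm_cancel power2_abs)
  also have "\<dots> \<le> (\<Sum>j\<in>UNIV. \<bar>norm (x $ j)\<bar> * \<bar>norm ((a *v z) $ j)\<bar>)"
    by (rule order_trans[OF norm_sum]) (simp add: norm_mult)
  also have "\<dots> \<le> norm x * norm (a *v z)"
    unfolding norm_vec_def by (rule L2_set_mult_ineq)
  also have "\<dots> \<le> norm x * (matrix_norm a * norm y)"
    using norm_matrix_vector_mult_le[of a z] by (simp add: mult_left_mono norm_z)
  finally have "norm y * norm y \<le> matrix_norm a * norm x * norm y"
    by (simp add: power2_eq_square mult_ac)
  then show "norm (transpose a *v x) \<le> matrix_norm a * norm x"
    unfolding y_def[symmetric]
    using matrix_norm_nonneg[of a] by (cases "y = 0") auto
qed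

theorem theorem2p3:
  fixes T :: "complex^'n^'n \<Rightarrow> complex^'n^'n"
  assumes "Vector_Spaces.linear matrix_scale matrix_scale T"
    and "surj T"
  shows "schur_multiplicative T \<and> contractive T \<longleftrightarrow>
    (\<exists>u v. permutation_unitary u \<and> permutation_unitary v \<and>
       ((\<forall>a. T a = u ** a ** v) \<or> (\<forall>a. T a = u ** transpose a ** v)))"
    (is "?L \<longleftrightarrow> ?R")
proof -
  have "?R \<longleftrightarrow>
      (\<exists>u v. permutation_unitary u \<and> permutation_unitary v \<and> (\<forall>a. T a = u ** a ** v)) \<or>
      (\<exists>u v. permutation_unitary u \<and> permutation_unitary v \<and> (\<forall>a. T a = u ** transpose a ** v))"
    by blast
  then have R_iff: "?R \<longleftrightarrow>
      (\<exists>f g. bij f \<and> bij g \<and> (\<forall>a i j. T a $ i $ j = a $ f i $ g j)) \<or>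
      (\<exists>f g. bij f \<and> bij g \<and> (\<forall>a i j. T a $ i $ j = transpose a $ f i $ g j))"
    unfolding ex_permutation_unitary_iff[of T "\<lambda>a. a"] ex_permutation_unitary_iff[of T transpose] .
  show ?thesis
  proof
    assume ?L
    then have mult: "schur_multiplicative T" and contr: "\<And>a. matrix_norm (T a) \<le> matrix_norm a"
      using contractive_iff_matrix_norm_le[OF assms(1)] by auto
    obtain \<sigma> where \<sigma>: "inj \<sigma>" "\<And>a i j. T a $ i $ j = a $ fst (\<sigma> (i, j)) $ snd (\<sigma> (i, j))"
      using schur_multiplicative_surj_rearranges[OF assms mult] by blast
    obtain f g where fg: "inj f" "inj g"
      "(\<forall>i j. \<sigma> (i, j) = (f i, g j)) \<or> (\<forall>i j. \<sigma> (i, j) = (g j, f i))"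
      using line_preserving_injection[OF \<sigma>(1) contractive_rearrangement_preserves_lines[OF contr \<sigma>]]
      by blast
    then have "(\<forall>a i j. T a $ i $ j = a $ f i $ g j) \<or> (\<forall>a i j. T a $ i $ j = transpose a $ f i $ g j)"
      by (auto simp: \<sigma>(2) transpose_def)
    moreover have "bij f" "bij g"
      using fg by (simp_all add: bij_def finite_UNIV_inj_surj)
    ultimately show ?R
      unfolding R_iff by blast
  next
    assume ?R
    then obtain f g where fg: "bij f" "bij g"
      and T: "(\<forall>a. T a = (\<chi> i j. a $ f i $ g j)) \<or> (\<forall>a. T a = (\<chi> i j. transpose a $ f i $ g j))"
      unfolding R_iff by (auto simp: vec_eq_iff)
    have "schur_multiplicative T"
      using T by (auto simp: schur_multiplicative_def vec_eq_iff transpose_def)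
    moreover have "matrix_norm (T a) \<le> matrix_norm a" for a
      using T
    proof
      assume "\<forall>a. T a = (\<chi> i j. a $ f i $ g j)"
      then show ?thesis
        by (simp add: matrix_norm_reindex_le[OF fg])
    next
      assume "\<forall>a. T a = (\<chi> i j. transpose a $ f i $ g j)"
      then have "matrix_norm (T a) \<le> matrix_norm (transpose a)"
        by (simp only: matrix_norm_reindex_le[OF fg])
      also have "\<dots> \<le> matrix_norm a"
        by (rule matrix_norm_transpose_le)
      finally show ?thesis .
    qed
    ultimately show ?L
      using contractive_iff_matrix_norm_le[OF assms(1)] by blast
  qed
qed

end
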